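(* Consider $N$ agents with linear dynamics $\dot x_i=A_ix_i+B_iu_i$, $y_i=C_ix_i$ ($i=1,\dots,N$), satisfying assumptions (A1)–(A4) of the context, and let $y^*=(y_1^*,\dots,y_N^* )\in\mathcal Y$ be the optimal solution of the problem of minimizing $\int_0^T f(t,y)\,dt$ over $y\in\mathcal Y$ subject to $\sum_{i=1}^N g_i(t,y_i)\le \mathbf 0$ for all $t\in[0,T]$. Let every agent apply the continuous-communication controller $$u_i=-K_{\alpha_i}x_i+K_{\beta_i}\,\Pi_{\mathcal Y_i}\big[y_i,-\varepsilon \mathcal H_i^{y_i}(t,y_i,\mu_i)\big],\qquad \dot\mu_i=\Pi_{\mathbb R_+^q}\big[\mu_i,\varepsilon \mathcal H_i^{\mu_i}(t,y_i,\mu_i)\big],\qquad \mu_i(0)=\mathbf 0,$$ where $\mathcal H_i^{y_i}$, $\mathcal H_i^{\mu_i}$, $K_{\alpha_i}$, $K_{\beta_i}$ are defined in the context. Then for any $T\ge 0$ and any $\varepsilon>0$, by choosing $K_\mu\ge NK_g$, the resulting output trajectory $y(t)=\mathrm{col}(y_1(t),\dots,y_N(t))$ satisfies $$\mathcal F^T:=\left\|\left[\int_0^T\sum_{i=1}^N g_i(t,y_i(t))\,dt\right]_+\right\|\ \le\ \frac{\sqrt N\,\|y(0)-y^*\|}{\varepsilon}+2N\sqrt{\frac{K_f}{\varepsilon}}\,\sqrt T .$$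
   Context: Agent $i$ has state $x_i\in\mathbb R^{n_i}$, input $u_i\in\mathbb R^{m_i}$, output $y_i\in\mathbb R^{p_i}$, with real matrices $A_i,B_i,C_i$ of compatible sizes; an output set $\mathcal Y_i\subseteq\mathbb R^{p_i}$ such that $y_i\in\mathcal Y_i$; a cost function $f_i(t,\cdot):\mathbb R^{p_i}\to\mathbb R$; and a constraint function $g_i(t,\cdot):\mathbb R^{p_i}\to\mathbb R^q$ with components $g_{i,1},\dots,g_{i,q}$. Write $\mathcal Y=\mathcal Y_1\times\cdots\times\mathcal Y_N$, $y=\mathrm{col}(y_1,\dots,y_N)$ (stacked vector), $f(t,y)=\sum_{i=1}^N f_i(t,y_i)$. The norm $\|\cdot\|$ is Euclidean and $\|\cdot\|_1$ is the 1-norm; vector inequalities are componentwise; $\mathbb R^q_+$ is the nonnegative orthant, and $[\cdot]_+$ is Euclidean projection onto it (componentwise positive part). Assumptions. (A1) The communication graph on $\{1,\dots,N\}$ is undirected and connected; $a_{ij}=a_{ji}=1$ if $\{i,j\}$ is an edge and $a_{ij}=0$ otherwise. (A2) Each $\mathcal Y_i$ is convex and compact; for $t\in[0,T]$, the functions $f_i(t,y_i)$ and (componentwise) $g_i(t,y_i)$ are convex, integrable and bounded on $\mathcal Y_i$, i.e. there are constants $K_f,K_g>0$ with $|f_i(t,y_i)|\le K_f$ and $\|g_i(t,y_i)\|\le K_g$. (A3) The set $\{y\in\mathcal Y:\ \sum_{i=1}^N g_i(t,y_i)\le \mathbf 0,\ t\in[0,T]\}$ is nonempty. (A4) $(A_i,B_i)$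 is controllable and $\mathrm{rank}(C_iB_i)=p_i$ for each $i$. Feedback matrices: $K_{\alpha_i},K_{\beta_i}$ are solutions of $C_iB_iK_{\alpha_i}=C_iA_i$ and $C_iB_iK_{\beta_i}=I_{p_i}$ (solutions exist by (A4)). Projection: for a closed convex set $\mathcal S\subseteq\mathbb R^n$, $x\in\mathcal S$, $v\in\mathbb R^n$, $\Pi_{\mathcal S}[x,v]=\lim_{\xi\to0^+}\frac{P_{\mathcal S}(x+\xi v)-x}{\xi}$, where $P_{\mathcal S}$ is Euclidean projection onto $\mathcal S$. Lagrangian: agent $i$ has a multiplier $\mu_i\in\mathbb R_+^q$ and, with a preset parameter $K_\mu>0$, $\mathcal H_i(t,y_i,\mu_i)=f_i(t,y_i)+\mu_i^\top g_i(t,y_i)-K_\mu\sum_{j=1}^N a_{ij}\|\mu_i-\mu_j\|_1$. $\mathcal H_i^{y_i}(t,y_i,\mu_i)$ denotes a subgradient in $y_i$: an element of $\partial f_i(t,y_i)+\sum_{k=1}^q\mu_{i,k}\,\partial g_{i,k}(t,y_i)$. $\mathcal H_i^{\mu_i}(t,y_i,\mu_i)$ denotes a subgradient in $\mu_i$ (of a concave function): an element of $g_i(t,y_i)-K_\mu\sum_{j=1}^N a_{ij}\,\mathrm{sgn}(\mu_i-\mu_j)$, where $\mathrm{sgn}$ acts componentwise and is set-valued: $\mathrm{sgn}(s)=\{-1\}$ for $s<0$, $[-1,1]$ for $s=0$, $\{1\}$ for $s>0$. Trajectories are absolutely continuous functions $(x_i,\mu_i)$ on $[0,T]$ satisfying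 the closed-loop equations for almost every $t$, with $y_i(t)\in\mathcal Y_i$ (in particular $y_i(0)\in\mathcal Y_i$) and $\mu_i(t)\in\mathbb R^q_+$.
   Formalization: The values selected from the set-valued sgn(μ_i−μ_j) and sgn(μ_j−μ_i) are required to be opposite (one selection per edge); with independent selections at ties the stated bound fails, since all multipliers can stay at zero. *)

theory Defs
  imports "HOL-Analysis.Analysis"
begin

text \<open>
  The agents have different state, input and output dimensions. A space of dimension \<open>d\<close> is
  represented inside \<open>real ^ 'k\<close> by the vectors supported on an index set \<open>J :: 'k set\<close> with
  \<open>card J = d\<close>, and a matrix between two such spaces by a matrix vanishing outside the
  corresponding block. Inner product, norm, products and rank then agree with those of the
  unpadded objects. The index types are arbitrary, so all dimension profiles are covered.
\<close>

definition coord_space :: "'k::finite set \<Rightarrow> (real^'k) set" where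
  "coord_space J = {v. \<forall>k. k \<notin> J \<longrightarrow> v $ k = 0}"

definition block_mat :: "'r::finite set \<Rightarrow> 'c::finite set \<Rightarrow> (real^'c^'r) set" where
  "block_mat R J = {M. \<forall>r c. \<not> (r \<in> R \<and> c \<in> J) \<longrightarrow> M $ r $ c = 0}"

definition block_id :: "'k::finite set \<Rightarrow> real^'k^'k" where
  "block_id J = (\<chi> r c. if r = c \<and> r \<in> J then 1 else 0)"

definition controllable ::
  "'n::finite set \<Rightarrow> 'm::finite set \<Rightarrow> real^'n^'n \<Rightarrow> real^'m^'n \<Rightarrow> bool" where
  "controllable S U A B \<longleftrightarrow>
     (\<forall>x0\<in>coord_space S. \<forall>x1\<in>coord_space S. \<exists>\<tau>>0. \<exists>u x.
        continuous_on {0..\<tau>} u \<and> (\<forall>t\<in>{0..\<tau>}. u t \<in> coord_space U) \<and>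
        (\<forall>t\<in>{0..\<tau>}. (x has_vector_derivative (A *v x t + B *v u t)) (at t within {0..\<tau>})) \<and>
        x 0 = x0 \<and> x \<tau> = x1)"

definition adj :: "('v \<times> 'v) set \<Rightarrow> 'v \<Rightarrow> 'v \<Rightarrow> real" where
  "adj E i j = (if (i, j) \<in> E then 1 else 0)"

text \<open>Simple undirected connected graph; \<open>E\<close> holds both orientations of each edge.\<close>

definition connected_ugraph :: "('v \<times> 'v) set \<Rightarrow> bool" where
  "connected_ugraph E \<longleftrightarrow> sym E \<and> irrefl E \<and> (\<forall>i j. (i, j) \<in> E\<^sup>*)"

definition nonneg_orthant :: "(real^'q::finite) set" where
  "nonneg_orthant = {v. 0 \<le> v}"

definition pos_part_vec :: "real^'q::finite \<Rightarrow> real^'q" where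
  "pos_part_vec v = closest_point nonneg_orthant v"

definition proj_dir :: "'a::euclidean_space set \<Rightarrow> 'a \<Rightarrow> 'a \<Rightarrow> 'a" where
  "proj_dir S x v =
     Lim (at_right 0) (\<lambda>\<xi>::real. (closest_point S (x + \<xi> *\<^sub>R v) - x) /\<^sub>R \<xi>)"

text \<open>
  Subgradients, in the space \<open>W\<close>, of a function that is convex on \<open>D \<subseteq> W\<close>; the subgradient
  inequality is required on \<open>D\<close>. Subgradients with respect to a larger set are included.
\<close>

definition subdiff ::
  "'a::real_inner set \<Rightarrow> 'a set \<Rightarrow> ('a \<Rightarrow> real) \<Rightarrow> 'a \<Rightarrow> 'a set" where
  "subdiff W D \<phi> z = {s \<in> W. \<forall>w\<in>D. \<phi> w \<ge> \<phi> z + s \<bullet> (w - z)}"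

definition Sgn :: "real \<Rightarrow> real set" where
  "Sgn s = (if s < 0 then {-1} else if s = 0 then {-1..1} else {1})"

definition Sgn_vec :: "real^'q::finite \<Rightarrow> (real^'q) set" where
  "Sgn_vec v = {w. \<forall>k. w $ k \<in> Sgn (v $ k)}"

text \<open>Subgradients in \<open>y\<close> of \<open>\<phi> y + \<mu>\<^sup>T \<gamma> y\<close>.\<close>

definition lagr_subgrad_y ::
  "(real^'p) set \<Rightarrow> (real^'p) set \<Rightarrow> (real^'p::finite \<Rightarrow> real) \<Rightarrow> (real^'p \<Rightarrow> real^'q::finite)
     \<Rightarrow> real^'p \<Rightarrow> real^'q \<Rightarrow> (real^'p) set" where
  "lagr_subgrad_y W D \<phi> \<gamma> z \<mu> =
     {hf + (\<Sum>k\<in>UNIV. \<mu> $ k *\<^sub>R hg k) |hf hg.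
        hf \<in> subdiff W D \<phi> z \<and> (\<forall>k. hg k \<in> subdiff W D (\<lambda>w. \<gamma> w $ k) z)}"

text \<open>
  The families \<open>(h\<^sub>i)\<^sub>i\<close> with \<open>h\<^sub>i \<in> \<gamma>\<^sub>i - K \<Sum>\<^sub>j a\<^sub>i\<^sub>j sgn (\<mu>\<^sub>i - \<mu>\<^sub>j)\<close>. As \<open>sgn\<close> is odd,
  \<open>sgn (\<mu>\<^sub>i - \<mu>\<^sub>j)\<close> and \<open>sgn (\<mu>\<^sub>j - \<mu>\<^sub>i)\<close> denote opposite values, also where \<open>sgn 0\<close> is
  multivalued: one selection is made for each edge, hence the set is defined for all agents
  jointly. Unrelated selections at the two ends of an edge would allow all multipliers to
  stay at zero forever.
\<close>

definition lagr_subgrad_mu ::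
  "('v::finite \<times> 'v) set \<Rightarrow> real \<Rightarrow> ('v \<Rightarrow> real^'q::finite) \<Rightarrow> ('v \<Rightarrow> real^'q)
     \<Rightarrow> ('v \<Rightarrow> real^'q) set" where
  "lagr_subgrad_mu E K \<gamma> \<mu> =
     {h. \<exists>s. (\<forall>i j. s i j \<in> Sgn_vec (\<mu> i - \<mu> j)) \<and> (\<forall>i j. s j i = - s i j) \<and>
          (\<forall>i. h i = \<gamma> i - K *\<^sub>R (\<Sum>j\<in>UNIV. adj E i j *\<^sub>R s i j))}"

definition abs_continuous_on :: "real \<Rightarrow> real \<Rightarrow> (real \<Rightarrow> 'a::real_normed_vector) \<Rightarrow> bool" where
  "abs_continuous_on a b \<phi> \<longleftrightarrow>
     (\<forall>e>0. \<exists>d>0. \<forall>\<D> S. \<D> division_of S \<and> S \<subseteq> {a..b} \<and> (\<Sum>K\<in>\<D>. Sup K - Inf K) < d \<longrightarrow>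
        (\<Sum>K\<in>\<D>. norm (\<phi> (Sup K) - \<phi> (Inf K))) < e)"

definition feasible ::
  "real \<Rightarrow> ('v::finite \<Rightarrow> (real^'p::finite) set) \<Rightarrow> ('v \<Rightarrow> real \<Rightarrow> real^'p \<Rightarrow> real^'q::finite)
     \<Rightarrow> (real^'p^'v) set" where
  "feasible T Y g = {y. (\<forall>i. y $ i \<in> Y i) \<and> (\<forall>t\<in>{0..T}. (\<Sum>i\<in>UNIV. g i t (y $ i)) \<le> 0)}"

end

theory Submission
  imports Defs
begin

text \<open>
  Along the closed loop \<open>y\<^sub>i\<close> follows the projected flow, since the feedback cancels \<open>C\<^sub>i A\<^sub>i x\<^sub>i\<close>.
  For a fixed consensus multiplier \<open>m \<ge> 0\<close> consider
  \<open>V = \<Sum>\<^sub>i (\<parallel>y\<^sub>i - y\<^sub>i\<^sup>*\<parallel>\<^sup>2 + \<parallel>\<mu>\<^sub>i - m\<parallel>\<^sup>2)\<close>. Convexity and the variational inequality of the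
  projections bound \<open>V'\<close> by \<open>2 \<epsilon> (2 N K\<^sub>f - m \<bullet> \<Sum>\<^sub>i g\<^sub>i(t, y\<^sub>i))\<close>: the remaining term,
  \<open>\<Sum>\<^sub>i \<mu>\<^sub>i \<bullet> g\<^sub>i(t, y\<^sub>i\<^sup>*)\<close>, is at most \<open>N K\<^sub>g\<close> times the disagreement of the multipliers and is
  absorbed by the consensus penalty because \<open>K\<^sub>\<mu> \<ge> N K\<^sub>g\<close>. Integrating and choosing \<open>m\<close> as \<open>\<epsilon> / N\<close> times the
  positive part of the integrated constraint gives a quadratic inequality for the latter's norm.
\<close>

section \<open>Metric projections and the projected direction\<close>

text \<open>The obtuse-angle property of the projection gives \<open>(dist w p)\<^sup>2 \<le> (dist
  v w)\<^sup>2 - (dist v p)\<^sup>2\<close>. Points of \<open>K\<close> almost as near to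
  \<open>v\<close> as the projection \<open>p\<close> are therefore near \<open>p\<close> itself, so
  convergence of distances yields convergence of points.\<close>

lemma closest_point_near:
  fixes v :: "'a::euclidean_space"
  assumes "convex K" "closed K" "w \<in> K" "dist v w \<le> dist v (closest_point K v) + \<delta>" "\<delta> \<ge> 0"
  shows "(dist w (closest_point K v))\<^sup>2 \<le> \<delta> * (2 * dist v (closest_point K v) + \<delta>)"
proof -
  let ?p = "closest_point K v"
  have "(v - ?p) \<bullet> (w - ?p) \<le> 0"
    using assms closest_point_dot by blast
  then have "(dist w ?p)\<^sup>2 \<le> (dist v w)\<^sup>2 - (dist v ?p)\<^sup>2"
    unfolding dist_norm power2_norm_eq_inner by (simp add: algebra_simps inner_commute)
  also have "\<dots> \<le> (dist v ?p + \<delta>)\<^sup>2 - (dist v ?p)\<^sup>2"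
    using assms by (simp add: power_mono)
  finally show ?thesis by (simp add: power2_eq_square algebra_simps)
qed

text \<open>The residual of projecting \<open>x + \<xi> *\<^sub>R v\<close> is
  \<open>\<xi> *\<^sub>R (v - w)\<close>, so the obtuse-angle inequality can be divided by
  \<open>\<xi>\<close>. What separates it from the variational inequality of the limit is a term
  carrying a factor \<open>\<xi>\<close>.\<close>

lemma difference_quotient_variational:
  fixes S :: "'a::euclidean_space set" and v :: 'a
  assumes S: "convex S" "closed S" "x \<in> S" and z: "z \<in> S" and \<xi>: "\<xi> > 0"
  defines "w \<equiv> (closest_point S (x + \<xi> *\<^sub>R v) - x) /\<^sub>R \<xi>"
  shows "(v - w) \<bullet> (z - x) \<le> \<xi> * ((v - w) \<bullet> w)"
proof -
  have w: "closest_point S (x + \<xi> *\<^sub>R v) = x + \<xi> *\<^sub>R w"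
    using \<xi> by (simp add: w_def)
  have "(x + \<xi> *\<^sub>R v - (x + \<xi> *\<^sub>R w)) \<bullet> (z - (x + \<xi> *\<^sub>R w)) \<le> 0"
    using closest_point_dot[OF S(1,2) z] by (metis w)
  then have "\<xi> * ((v - w) \<bullet> (z - x - \<xi> *\<^sub>R w)) \<le> 0"
    by (simp add: algebra_simps)
  then have "(v - w) \<bullet> (z - x - \<xi> *\<^sub>R w) \<le> 0"
    using \<xi> by (simp add: mult_le_0_iff)
  then show ?thesis by (simp add: inner_diff_right)
qed

text \<open>The quotients are the closest points to \<open>v\<close> of the sets \<open>(S - x) / \<xi>\<close>, which increase as
  \<open>\<xi>\<close> decreases; hence they converge to the closest point of the closed union.\<close>

lemma proj_dir_tendsto:
  fixes S :: "'a::euclidean_space set"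
  assumes S: "convex S" "closed S" "x \<in> S"
  shows "((\<lambda>\<xi>::real. (closest_point S (x + \<xi> *\<^sub>R v) - x) /\<^sub>R \<xi>) \<longlongrightarrow> proj_dir S x v) (at_right 0)"
proof -
  define w where "w \<xi> = (closest_point S (x + \<xi> *\<^sub>R v) - x) /\<^sub>R \<xi>" for \<xi> :: real
  \<comment> \<open>\<open>Q\<close> is the cone of feasible directions of \<open>S\<close> at
    \<open>x\<close>; its closure \<open>K\<close> is the tangent cone, and the limit will be the
    projection of \<open>v\<close> onto it.\<close>
  define Q where "Q = {d. \<exists>\<xi>>0. x + \<xi> *\<^sub>R d \<in> S}"
  \<comment> \<open>\<open>S\<close> is star-shaped about \<open>x\<close>, so a direction feasible
    for one step size is feasible for all smaller ones.\<close>
  have shrink: "x + \<eta> *\<^sub>R d \<in> S" if "x + \<xi> *\<^sub>R d \<in> S" "0 < \<eta>" "\<eta> \<le> \<xi>" for \<xi> \<eta> d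
  proof -
    have "(1 - \<eta> / \<xi>) *\<^sub>R x + (\<eta> / \<xi>) *\<^sub>R (x + \<xi> *\<^sub>R d) \<in> S"
      using that S by (intro convexD) auto
    then show ?thesis using that by (simp add: algebra_simps)
  qed
  have "convex Q"
  proof (rule convexI)
    fix d e and s t :: real
    assume de: "d \<in> Q" "e \<in> Q" and st: "0 \<le> s" "0 \<le> t" "s + t = 1"
    then obtain \<xi> \<eta> where *: "\<xi> > 0" "\<eta> > 0" "x + \<xi> *\<^sub>R d \<in> S" "x + \<eta> *\<^sub>R e \<in> S"
      by (auto simp: Q_def)
    define \<zeta> where "\<zeta> = min \<xi> \<eta>"
    have \<zeta>: "\<zeta> > 0" "x + \<zeta> *\<^sub>R d \<in> S" "x + \<zeta> *\<^sub>R e \<in> S"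
      using * shrink unfolding \<zeta>_def by auto
    have "s *\<^sub>R (x + \<zeta> *\<^sub>R d) + t *\<^sub>R (x + \<zeta> *\<^sub>R e) \<in> S"
      using \<zeta> st S by (intro convexD) auto
    moreover have "s *\<^sub>R (x + \<zeta> *\<^sub>R d) + t *\<^sub>R (x + \<zeta> *\<^sub>R e) = (s + t) *\<^sub>R x + \<zeta> *\<^sub>R (s *\<^sub>R d + t *\<^sub>R e)"
      by (simp add: algebra_simps)
    ultimately show "s *\<^sub>R d + t *\<^sub>R e \<in> Q"
      using st \<zeta> by (auto simp: Q_def)
  qed
  define K where "K = closure Q"
  have "0 \<in> Q" using S by (auto simp: Q_def intro: exI[of _ 1])
  have K: "convex K" "closed K" "K \<noteq> {}"
    using \<open>convex Q\<close> \<open>0 \<in> Q\<close> closure_subset by (auto simp: K_def convex_closure)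
  define p where "p = closest_point K v"
  have "(w \<longlongrightarrow> p) (at_right 0)"
  proof (rule tendstoI)
    fix e :: real assume "e > 0"
    \<comment> \<open>The bound of \<open>closest_point_near\<close> tends to 0 with its slack,
      which allows a slack that forces distance below \<open>e\<close>.\<close>
    have "((\<lambda>\<delta>. \<delta> * (2 * dist v p + \<delta>)) \<longlongrightarrow> 0 * (2 * dist v p + 0)) (at_right 0)"
      by (intro tendsto_intros)
    then have "\<forall>\<^sub>F \<delta> in at_right 0. \<delta> * (2 * dist v p + \<delta>) < e\<^sup>2"
      using \<open>e > 0\<close> by (intro order_tendstoD(2)) auto
    then have "\<forall>\<^sub>F \<delta> in at_right 0. \<delta> * (2 * dist v p + \<delta>) < e\<^sup>2 \<and> \<delta> > 0"
      by (rule eventually_conj) (rule eventually_at_right_less)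
    then obtain \<delta> where \<delta>: "\<delta> > 0" "\<delta> * (2 * dist v p + \<delta>) < e\<^sup>2"
      using eventually_happens by force
    have "p \<in> closure Q"
      unfolding p_def K_def[symmetric] using K by (intro closest_point_in_set)
    then obtain d where d: "d \<in> Q" "dist d p < \<delta>"
      using \<delta> closure_approachable by blast
    \<comment> \<open>The near-optimal direction \<open>d\<close> becomes a competitor for the
      projection as soon as the step is below \<open>\<xi>0\<close>; this makes
      \<open>w \<xi>\<close> at least as close to \<open>v\<close> as \<open>d\<close> is.\<close>
    then obtain \<xi>0 where \<xi>0: "\<xi>0 > 0" "x + \<xi>0 *\<^sub>R d \<in> S"
      by (auto simp: Q_def)
    have "dist (w \<xi>) p < e" if \<xi>: "0 < \<xi>" "\<xi> < \<xi>0" for \<xi>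
    proof -
      have x\<xi>: "x + \<xi> *\<^sub>R d \<in> S" using shrink \<xi>0 \<xi> by simp
      have wS: "x + \<xi> *\<^sub>R w \<xi> = closest_point S (x + \<xi> *\<^sub>R v)"
        using \<xi> by (simp add: w_def)
      have "dist (x + \<xi> *\<^sub>R v) (x + \<xi> *\<^sub>R w \<xi>) \<le> dist (x + \<xi> *\<^sub>R v) (x + \<xi> *\<^sub>R d)"
        unfolding wS using x\<xi> S by (intro closest_point_le) auto
      then have "dist v (w \<xi>) \<le> dist v d"
        using \<xi> by (simp add: dist_norm flip: scaleR_diff_right)
      also have "\<dots> \<le> dist v p + \<delta>"
        using d(2) dist_triangle[of v d p] by (simp add: dist_commute)
      finally have le: "dist v (w \<xi>) \<le> dist v p + \<delta>" .
      have "x + \<xi> *\<^sub>R w \<xi> \<in> S"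
        unfolding wS using S by (intro closest_point_in_set) auto
      then have "w \<xi> \<in> Q"
        using \<xi>(1) by (auto simp: Q_def)
      then have "w \<xi> \<in> K"
        unfolding K_def by (rule subsetD[OF closure_subset])
      then have "(dist (w \<xi>) p)\<^sup>2 < e\<^sup>2"
        using closest_point_near[OF K(1,2) _ le[unfolded p_def]] \<delta> unfolding p_def
        by (meson le_less_trans less_imp_le)
      then show ?thesis using \<open>e > 0\<close> by (intro power2_less_imp_less[of _ e]) auto
    qed
    then show "\<forall>\<^sub>F \<xi> in at_right 0. dist (w \<xi>) p < e"
      using \<xi>0(1) eventually_at_right_field by blast
  qed
  \<comment> \<open>\<open>proj_dir\<close> is a \<open>Lim\<close>, so its value can be identified
    only after convergence has been established.\<close>
  moreover from this have "proj_dir S x v = p"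
    unfolding proj_dir_def w_def[symmetric] by (intro tendsto_Lim) auto
  ultimately show ?thesis unfolding w_def by simp
qed

text \<open>The limit of \<open>difference_quotient_variational\<close> as the step tends to 0.
  Along \<open>x - z\<close> the projected velocity may be replaced by the raw one, which removes
  all projections from the Lyapunov estimate.\<close>

lemma proj_dir_inner_le:
  fixes S :: "'a::euclidean_space set"
  assumes S: "convex S" "closed S" "x \<in> S" "z \<in> S"
  shows "(x - z) \<bullet> proj_dir S x v \<le> (x - z) \<bullet> v"
proof -
  define w where "w \<xi> = (closest_point S (x + \<xi> *\<^sub>R v) - x) /\<^sub>R \<xi>" for \<xi> :: real
  have w: "(w \<longlongrightarrow> proj_dir S x v) (at_right 0)"
    unfolding w_def by (rule proj_dir_tendsto[OF S(1-3)])
  have "(v - proj_dir S x v) \<bullet> (z - x) \<le> 0 * ((v - proj_dir S x v) \<bullet> proj_dir S x v)"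
  proof (rule tendsto_le)
    show "((\<lambda>\<xi>. \<xi> * ((v - w \<xi>) \<bullet> w \<xi>)) \<longlongrightarrow> 0 * ((v - proj_dir S x v) \<bullet> proj_dir S x v)) (at_right 0)"
      by (intro tendsto_intros w)
    show "((\<lambda>\<xi>. (v - w \<xi>) \<bullet> (z - x)) \<longlongrightarrow> (v - proj_dir S x v) \<bullet> (z - x)) (at_right 0)"
      by (intro tendsto_intros w)
    show "\<forall>\<^sub>F \<xi> in at_right 0. (v - w \<xi>) \<bullet> (z - x) \<le> \<xi> * ((v - w \<xi>) \<bullet> w \<xi>)"
      using eventually_at_right_less unfolding w_def
      by (rule eventually_mono) (rule difference_quotient_variational[OF S])
  qed simp
  then show ?thesis by (simp add: inner_diff_left inner_diff_right inner_commute)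
qed

text \<open>The difference quotients lie in the closed set \<open>W\<close>. With \<open>W\<close>
  the padded output space, this makes the feedback gain act as the identity on the projected
  direction.\<close>

lemma proj_dir_in_subspace:
  fixes S :: "'a::euclidean_space set"
  assumes S: "convex S" "closed S" "x \<in> S" and W: "subspace W" "S \<subseteq> W"
  shows "proj_dir S x v \<in> W"
proof (rule Lim_in_closed_set[OF closed_subspace[OF W(1)] _ _ proj_dir_tendsto[OF S]])
  show "\<forall>\<^sub>F \<xi>::real in at_right 0. (closest_point S (x + \<xi> *\<^sub>R v) - x) /\<^sub>R \<xi> \<in> W"
    using W S closest_point_in_set[of S]
    by (intro always_eventually allI subspace_scale subspace_diff) auto
qed simp

section \<open>Disagreement along paths of the communication graph\<close>

text \<open>A walk of least length repeats no vertex, since cutting out the loop between two visits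
  would shorten it.\<close>

lemma rtrancl_simple_path:
  assumes "(i, j) \<in> E\<^sup>*"
  obtains n p where "p 0 = i" "p n = j" "inj_on p {..n}" "\<And>k. k < n \<Longrightarrow> (p k, p (Suc k)) \<in> E"
proof -
  define n where "n = (LEAST n. (i, j) \<in> E ^^ n)"
  have "\<exists>n. (i, j) \<in> E ^^ n" using assms rtrancl_power by blast
  then have "(i, j) \<in> E ^^ n" unfolding n_def by (rule LeastI_ex)
  then obtain p where p: "p 0 = i" "p n = j" "\<forall>k<n. (p k, p (Suc k)) \<in> E"
    unfolding relpow_fun_conv by blast
  have "p a \<noteq> p b" if "a < b" "b \<le> n" for a b
  proof
    assume eq: "p a = p b"
    have "(i, p a) \<in> E ^^ a"
      unfolding relpow_fun_conv using p that by (intro exI[of _ p]) auto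
    moreover have "(p b, j) \<in> E ^^ (n - b)"
      unfolding relpow_fun_conv using p that by (intro exI[of _ "\<lambda>k. p (b + k)"]) auto
    ultimately have "(i, j) \<in> E ^^ (a + (n - b))"
      using eq unfolding relpow_add by auto
    then have "n \<le> a + (n - b)" unfolding n_def by (rule Least_le)
    then show False using that by linarith
  qed
  then have "inj_on p {..n}"
    by (intro linorder_inj_onI) auto
  then show ?thesis using that p by blast
qed

text \<open>A simple path traverses every edge at most once, in one of its two orientations.\<close>

lemma norm_diff_le_half_edge_sum:
  fixes \<phi> :: "'v::finite \<Rightarrow> 'a::real_normed_vector"
  assumes "connected_ugraph E"
  shows "norm (\<phi> i - \<phi> j) \<le> (\<Sum>k\<in>UNIV. \<Sum>l\<in>UNIV. adj E k l * norm (\<phi> k - \<phi> l)) / 2"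
proof -
  define d where "d = (\<lambda>(k, l). norm (\<phi> k - \<phi> l))"
  have E: "sym E" "(i, j) \<in> E\<^sup>*"
    using assms by (auto simp: connected_ugraph_def)
  obtain n p where p: "p 0 = i" "p n = j" "inj_on p {..n}" "\<And>k. k < n \<Longrightarrow> (p k, p (Suc k)) \<in> E"
    using rtrancl_simple_path[OF E(2)] by blast
  have pinj: "a = b" if "p a = p b" "a \<le> n" "b \<le> n" for a b
    using p(3) that by (auto dest: inj_onD)
  \<comment> \<open>\<open>P\<close> and \<open>P'\<close> hold the path edges in forward and
    backward orientation. The double sum over ordered pairs counts both, whence the factor
    1/2.\<close>
  define P where "P = (\<lambda>k. (p k, p (Suc k))) ` {..<n}"
  define P' where "P' = (\<lambda>k. (p (Suc k), p k)) ` {..<n}"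
  have "norm (\<phi> (p 0) - \<phi> (p m)) \<le> (\<Sum>k<m. d (p k, p (Suc k)))" for m
  proof (induction m)
    case (Suc m)
    then show ?case
      using norm_triangle_ineq[of "\<phi> (p 0) - \<phi> (p m)" "\<phi> (p m) - \<phi> (p (Suc m))"] by (simp add: d_def)
  qed simp
  then have path: "norm (\<phi> i - \<phi> j) \<le> (\<Sum>k<n. d (p k, p (Suc k)))"
    using p by metis
  have sumP: "sum d P = (\<Sum>k<n. d (p k, p (Suc k)))"
    unfolding P_def by (subst sum.reindex) (auto simp: inj_on_def dest: pinj)
  have sumP': "sum d P' = (\<Sum>k<n. d (p k, p (Suc k)))"
    unfolding P'_def by (subst sum.reindex) (auto simp: inj_on_def d_def norm_minus_commute dest: pinj)
  \<comment> \<open>A common pair would give both \<open>a = Suc b\<close> and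
    \<open>b = Suc a\<close> by injectivity of the path.\<close>
  have disj: "P \<inter> P' = {}"
  proof -
    have False if "a < n" "b < n" "p a = p (Suc b)" "p (Suc a) = p b" for a b
      using pinj[of a "Suc b"] pinj[of "Suc a" b] that by linarith
    then show ?thesis by (auto simp: P_def P'_def)
  qed
  have "P \<union> P' \<subseteq> E"
    using p(4) \<open>sym E\<close> by (auto simp: P_def P'_def sym_def)
  then have "sum d (P \<union> P') \<le> sum d E"
    by (intro sum_mono2) (auto simp: d_def)
  moreover have "sum d (P \<union> P') = sum d P + sum d P'"
    using disj by (intro sum.union_disjoint) (auto simp: P_def P'_def)
  moreover have "sum d E = (\<Sum>k\<in>UNIV. \<Sum>l\<in>UNIV. adj E k l * norm (\<phi> k - \<phi> l))"
  proof -
    have "sum d E = (\<Sum>e\<in>UNIV. if e \<in> E then d e else 0)"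
      by (simp add: sum.If_cases)
    also have "\<dots> = (\<Sum>(k, l)\<in>UNIV \<times> UNIV. adj E k l * norm (\<phi> k - \<phi> l))"
      by (intro sum.cong) (auto simp: adj_def d_def)
    finally show ?thesis by (simp only: sum.cartesian_product)
  qed
  ultimately show ?thesis using path sumP sumP' by simp
qed

section \<open>Increments of absolutely continuous functions\<close>

text \<open>In a fine tagged division, the intervals tagged in \<open>N\<close> have small total length, so absolute
  continuity makes their increments negligible; at the other tags the derivative applies.\<close>

lemma abs_continuous_increment_le_integral:
  fixes F \<phi> :: "real \<Rightarrow> real"
  assumes ab: "a \<le> b" and AC: "abs_continuous_on a b F" and N: "negligible N"
    and der: "\<And>t. t \<in> {a..b} - N \<Longrightarrow>
      \<exists>D. (F has_vector_derivative D) (at t within {a..b}) \<and> D \<le> \<phi> t"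
    and int: "\<phi> integrable_on {a..b}"
  shows "F b - F a \<le> integral {a..b} \<phi>"
proof (rule field_le_epsilon)
  fix e' :: real assume "e' > 0"
  \<comment> \<open>Three errors add up to exactly \<open>e'\<close>: \<open>e\<close> from the tags
    in \<open>N\<close>, \<open>e\<close> from the Riemann sum, and \<open>e * (b - a)\<close> from
    the derivative estimates.\<close>
  define e where "e = e' / (b - a + 2)"
  have e: "e > 0" and ee: "e * (b - a + 2) = e'"
    using \<open>e' > 0\<close> ab by (auto simp: e_def)
  \<comment> \<open>Changing the integrand on a null set keeps its integral and makes it vanish at
    the tags where no derivative bound is available.\<close>
  define \<psi> where "\<psi> t = (if t \<in> N then 0 else \<phi> t)" for t
  have "(\<psi> has_integral integral {a..b} \<phi>) {a..b}"
    by (rule has_integral_spike[OF N _ integrable_integral[OF int]]) (auto simp: \<psi>_def)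
  then obtain \<gamma> where \<gamma>: "gauge \<gamma>"
    and \<gamma>_fine: "\<And>\<D>. \<D> tagged_division_of {a..b} \<Longrightarrow> \<gamma> fine \<D> \<Longrightarrow>
        norm ((\<Sum>(x, k)\<in>\<D>. measure lborel k *\<^sub>R \<psi> x) - integral {a..b} \<phi>) < e"
    using e unfolding has_integral_real by meson
  obtain d where d: "d > 0"
    and AC': "\<And>\<D> S. \<D> division_of S \<Longrightarrow> S \<subseteq> {a..b} \<Longrightarrow> (\<Sum>K\<in>\<D>. Sup K - Inf K) < d
                \<Longrightarrow> (\<Sum>K\<in>\<D>. norm (F (Sup K) - F (Inf K))) < e"
    using AC e unfolding abs_continuous_on_def by meson
  have "N \<in> sets lebesgue"
    using N negligible_iff_null_sets by blast
  then obtain U where U: "open U" "N \<subseteq> U" "U - N \<in> lmeasurable" "emeasure lebesgue (U - N) < ennreal d"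
    using sets_lebesgue_outer_open d by blast
  have Unull: "U = (U - N) \<union> N" "N \<in> lmeasurable" "measure lebesgue N = 0"
    using U(2) N negligible_iff_measure by auto
  then have Um: "U \<in> lmeasurable"
    using U(3) by (metis fmeasurable.Un)
  have "measure lebesgue U \<le> measure lebesgue (U - N) + measure lebesgue N"
    using measure_Un_le[of "U - N" lebesgue N] Unull U(3) by auto
  also have "\<dots> < d"
    using Unull(3) U(3,4) d by (simp add: emeasure_eq_measure2 ennreal_less_iff)
  finally have Ud: "measure lebesgue U < d" .
  \<comment> \<open>The radius serves two purposes: around tags in \<open>N\<close> it confines
    intervals to the small open set \<open>U\<close>, around the others it validates the derivative
    estimate.\<close>
  have "\<exists>r>0. (t \<in> N \<longrightarrow> ball t r \<subseteq> U) \<and>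
      (t \<in> {a..b} - N \<longrightarrow> (\<forall>u\<in>{a..b}. \<forall>v\<in>{a..b}. u \<le> t \<and> t \<le> v \<and> u \<in> ball t r \<and> v \<in> ball t r
         \<longrightarrow> F v - F u \<le> (v - u) * (\<phi> t + e)))" for t
  proof (cases "t \<in> N")
    case True
    then show ?thesis using U openE by (metis DiffD2 subsetD)
  next
    case nN: False
    show ?thesis
    proof (cases "t \<in> {a..b}")
      case False
      then show ?thesis using nN by (intro exI[of _ 1]) auto
    next
      case True
      then obtain D where D: "(F has_vector_derivative D) (at t within {a..b})" "D \<le> \<phi> t"
        using der nN by blast
      obtain r where r: "r > 0" and rF: "\<And>s. s \<in> {a..b} \<Longrightarrow> norm (s - t) < r \<Longrightarrow>
          norm (F s - F t - (s - t) *\<^sub>R D) \<le> e * norm (s - t)"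
        using D(1) e unfolding has_vector_derivative_def has_derivative_within_alt by meson
      \<comment> \<open>Straddle estimate: since \<open>t\<close> lies between \<open>u\<close> and
        \<open>v\<close>, the errors on the two sides add up to \<open>e * (v - u)\<close>.\<close>
      have "F v - F u \<le> (v - u) * (\<phi> t + e)"
        if "u \<in> {a..b}" "v \<in> {a..b}" "u \<le> t" "t \<le> v" "u \<in> ball t r" "v \<in> ball t r" for u v
      proof -
        have "norm (F v - F t - (v - t) * D) \<le> e * (v - t)"
          "norm (F u - F t - (u - t) * D) \<le> e * (t - u)"
          using rF[of v] rF[of u] that by (auto simp: dist_real_def abs_minus_commute)
        then have "F v - F u \<le> (v - u) * D + e * (v - u)"
          unfolding real_norm_def abs_le_iff by (simp add: algebra_simps)
        also have "\<dots> \<le> (v - u) * \<phi> t + e * (v - u)"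
          using that D(2) by (simp add: mult_left_mono)
        finally show ?thesis by (simp add: algebra_simps)
      qed
      then show ?thesis using r nN by blast
    qed
  qed
  then obtain r where r: "\<And>t. r t > 0" "\<And>t. t \<in> N \<Longrightarrow> ball t (r t) \<subseteq> U"
    and rF: "\<And>t u v. t \<in> {a..b} - N \<Longrightarrow> u \<in> {a..b} \<Longrightarrow> v \<in> {a..b} \<Longrightarrow> u \<le> t \<Longrightarrow> t \<le> v \<Longrightarrow>
        u \<in> ball t (r t) \<Longrightarrow> v \<in> ball t (r t) \<Longrightarrow> F v - F u \<le> (v - u) * (\<phi> t + e)"
    by metis
  have "gauge (\<lambda>t. \<gamma> t \<inter> ball t (r t))"
    using \<gamma> r(1) by (intro gauge_Int gauge_ball_dependent) auto
  then obtain p where p: "p tagged_division_of {a..b}" and "(\<lambda>t. \<gamma> t \<inter> ball t (r t)) fine p"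
    using fine_division_exists_real by blast
  then have fine: "\<gamma> fine p" "(\<lambda>t. ball t (r t)) fine p"
    by (auto simp: fine_Int)
  have pfin: "finite p"
    using p by blast
  have mem: "\<exists>u v. k = {u..v} \<and> u \<le> v \<and> u \<le> x \<and> x \<le> v \<and> u \<in> {a..b} \<and> v \<in> {a..b}
      \<and> k \<subseteq> ball x (r x) \<and> x \<in> {a..b}" if "(x, k) \<in> p" for x k
  proof -
    have "x \<in> k" "k \<subseteq> {a..b}"
      using tagged_division_ofD(2,3)[OF p] that by auto
    moreover have "\<exists>u v. k = {u..v}"
      using tagged_division_ofD(4)[OF p that] by simp
    then obtain u v where "k = {u..v}" by blast
    moreover have "k \<subseteq> ball x (r x)"
      using fineD[OF fine(2) that] .
    ultimately show ?thesis using atLeastatMost_subset_iff[of u v a b] by (intro exI[of _ u] exI[of _ v]) auto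
  qed
  define q where "q = {(x, k) \<in> p. x \<in> N}"
  have qp: "q \<subseteq> p" by (auto simp: q_def)
  have qpart: "q tagged_partial_division_of {a..b}"
    using p qp by (auto simp: tagged_division_of_def intro: tagged_partial_division_subset)
  define S where "S = \<Union> (snd ` q)"
  have qS: "q tagged_division_of S"
    unfolding S_def by (rule tagged_partial_division_of_Union_self[OF qpart])
  have div: "snd ` q division_of S"
    by (rule division_of_tagged_division[OF qS])
  have "S \<subseteq> {a..b}"
    using mem qp unfolding S_def by fastforce
  have "S \<subseteq> U"
  proof -
    have "k \<subseteq> U" if "(x, k) \<in> q" for x k
      using that mem[of x k] r(2)[of x] unfolding q_def by blast
    then show ?thesis unfolding S_def by force
  qed
  have len: "Sup k - Inf k = measure lebesgue k" if "(x, k) \<in> p" for x k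
    using mem[OF that] by auto
  have "(\<Sum>K\<in>snd ` q. Sup K - Inf K) = (\<Sum>K\<in>snd ` q. measure lebesgue K)"
    using len qp by (intro sum.cong) auto
  also have "\<dots> = measure lebesgue S"
    using content_division[OF div] .
  also have "\<dots> \<le> measure lebesgue U"
  proof (rule measure_mono_fmeasurable[OF \<open>S \<subseteq> U\<close> _ Um])
    have "k \<in> sets lebesgue" if "k \<in> snd ` q" for k
      using division_ofD(4)[OF div that] by auto
    then show "S \<in> sets lebesgue"
      unfolding S_def using division_ofD(1)[OF div] by blast
  qed
  also have "\<dots> < d" by (rule Ud)
  finally have small: "(\<Sum>K\<in>snd ` q. norm (F (Sup K) - F (Inf K))) < e"
    using AC'[OF div \<open>S \<subseteq> {a..b}\<close>] by blast
  have qsum: "(\<Sum>(x, k)\<in>q. F (Sup k) - F (Inf k)) \<le> e"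
  proof -
    have "(\<Sum>(x, k)\<in>q. F (Sup k) - F (Inf k)) = (\<Sum>k\<in>snd ` q. F (Sup k) - F (Inf k))"
    proof -
      \<comment> \<open>A degenerate interval may carry several tags, so passing from tagged pairs
        to intervals needs a function vanishing on all degenerate intervals; the empty one requires
        an explicit value.\<close>
      define D where "D k = (if k = {} then 0 else F (Sup k) - F (Inf k))" for k :: "real set"
      have ne: "D k = F (Sup k) - F (Inf k)" if "(x, k) \<in> q" for x k
        using mem[of x k] qp that by (auto simp: D_def)
      have "D (cbox u v) = 0" if "box u v = {}" for u v
        using that by (cases "u \<le> v") (auto simp: D_def)
      then have "(\<Sum>(x, k)\<in>q. D k) = (\<Sum>k\<in>snd ` q. D k)"
        by (rule sum.over_tagged_division_lemma[OF qS])
      moreover have "(\<Sum>(x, k)\<in>q. D k) = (\<Sum>(x, k)\<in>q. F (Sup k) - F (Inf k))"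
        using ne by (intro sum.cong) auto
      moreover have "(\<Sum>k\<in>snd ` q. D k) = (\<Sum>k\<in>snd ` q. F (Sup k) - F (Inf k))"
        using ne by (intro sum.cong) auto
      ultimately show ?thesis by simp
    qed
    also have "\<dots> \<le> (\<Sum>k\<in>snd ` q. norm (F (Sup k) - F (Inf k)))"
      by (intro sum_mono) auto
    finally show ?thesis using small by simp
  qed
  have psum: "(\<Sum>(x, k)\<in>p - q. F (Sup k) - F (Inf k)) \<le> (\<Sum>(x, k)\<in>p - q. measure lborel k * \<psi> x + e * measure lborel k)"
  proof (intro sum_mono, clarify)
    fix x k assume xk: "(x, k) \<in> p" "(x, k) \<notin> q"
    then obtain u v where uv: "k = {u..v}" "u \<le> v" "u \<le> x" "x \<le> v" "u \<in> {a..b}" "v \<in> {a..b}"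
      "k \<subseteq> ball x (r x)" "x \<in> {a..b}" using mem by meson
    have "x \<notin> N" using xk q_def by auto
    have "u \<in> k" "v \<in> k" using uv by auto
    then have "u \<in> ball x (r x)" "v \<in> ball x (r x)" using uv by blast+
    then have "F v - F u \<le> (v - u) * (\<phi> x + e)"
      using uv \<open>x \<notin> N\<close> by (intro rF) auto
    then show "F (Sup k) - F (Inf k) \<le> measure lborel k * \<psi> x + e * measure lborel k"
      using uv \<open>x \<notin> N\<close> by (simp add: \<psi>_def algebra_simps)
  qed
  have split: "(\<Sum>z\<in>p. h z) = (\<Sum>z\<in>q. h z) + (\<Sum>z\<in>p - q. h z)" for h :: "_ \<Rightarrow> real"
    using sum.subset_diff[OF qp pfin, of h] by simp
  have "F b - F a = (\<Sum>(x, k)\<in>p. F (Sup k) - F (Inf k))"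
    using additive_tagged_division_1[OF ab p, of F] by simp
  also have "\<dots> \<le> e + (\<Sum>(x, k)\<in>p - q. measure lborel k * \<psi> x + e * measure lborel k)"
    unfolding split using qsum psum by simp
  also have "\<dots> \<le> e + (\<Sum>(x, k)\<in>p. measure lborel k * \<psi> x + e * measure lborel k)"
  proof -
    \<comment> \<open>At tags in \<open>N\<close> the function \<open>\<psi>\<close> is 0, so
      restoring these terms adds only nonnegative multiples of \<open>e\<close>.\<close>
    have "0 \<le> (\<Sum>(x, k)\<in>q. measure lborel k * \<psi> x + e * measure lborel k)"
      using e by (intro sum_nonneg) (auto simp: q_def \<psi>_def)
    then show ?thesis unfolding split[of "\<lambda>(x, k). measure lborel k * \<psi> x + e * measure lborel k"] by simp
  qed
  also have "\<dots> = e + (\<Sum>(x, k)\<in>p. measure lborel k *\<^sub>R \<psi> x) + e * (\<Sum>(x, k)\<in>p. measure lborel k)"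
    by (simp add: sum.distrib sum_distrib_left case_prod_unfold)
  also have "(\<Sum>(x, k)\<in>p. measure lborel k) = b - a"
    using additive_content_tagged_division[of p a b] p ab by (simp add: box_real)
  also have "e + (\<Sum>(x, k)\<in>p. measure lborel k *\<^sub>R \<psi> x) + e * (b - a) \<le> integral {a..b} \<phi> + e * (b - a + 2)"
    using \<gamma>_fine[OF p fine(1)] by (simp add: algebra_simps abs_less_iff)
  finally show "F b - F a \<le> integral {a..b} \<phi> + e'" by (simp only: ee)
qed

section \<open>Closure properties of absolute continuity\<close>

lemma abs_continuous_onE:
  assumes "abs_continuous_on a b \<phi>" "e > 0"
  obtains d where "d > 0" "\<And>\<D> S. \<D> division_of S \<Longrightarrow> S \<subseteq> {a..b} \<Longrightarrow>
      (\<Sum>K\<in>\<D>. Sup K - Inf K) < d \<Longrightarrow> (\<Sum>K\<in>\<D>. norm (\<phi> (Sup K) - \<phi> (Inf K))) < e"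
  using assms unfolding abs_continuous_on_def by meson

lemma abs_continuous_on_dominated:
  assumes AC: "abs_continuous_on a b \<phi>"
    and dom: "\<And>s t. s \<in> {a..b} \<Longrightarrow> t \<in> {a..b} \<Longrightarrow> norm (F s - F t) \<le> L * norm (\<phi> s - \<phi> t)"
  shows "abs_continuous_on a b F"
  unfolding abs_continuous_on_def
proof (intro allI impI)
  fix e :: real assume e: "e > 0"
  \<comment> \<open>\<open>M\<close> dominates \<open>L\<close> and is positive whatever the sign of
    \<open>L\<close>, so \<open>e / M\<close> is an admissible tolerance.\<close>
  define M where "M = \<bar>L\<bar> + 1"
  have M: "M > 0" by (simp add: M_def)
  obtain d where d: "d > 0" and AC': "\<And>\<D> S. \<D> division_of S \<Longrightarrow> S \<subseteq> {a..b} \<Longrightarrow>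
      (\<Sum>K\<in>\<D>. Sup K - Inf K) < d \<Longrightarrow> (\<Sum>K\<in>\<D>. norm (\<phi> (Sup K) - \<phi> (Inf K))) < e / M"
    using abs_continuous_onE[OF AC divide_pos_pos[OF e M]] by blast
  have "(\<Sum>K\<in>\<D>. norm (F (Sup K) - F (Inf K))) < e"
    if *: "\<D> division_of S" "S \<subseteq> {a..b}" "(\<Sum>K\<in>\<D>. Sup K - Inf K) < d" for \<D> S
  proof -
    have "norm (F (Sup K) - F (Inf K)) \<le> M * norm (\<phi> (Sup K) - \<phi> (Inf K))" if "K \<in> \<D>" for K
    proof -
      have "\<exists>u v. K = cbox u v" "K \<noteq> {}" "K \<subseteq> {a..b}"
        using division_ofD(2-4)[OF *(1) that] *(2) by auto
      then have "Sup K \<in> {a..b}" "Inf K \<in> {a..b}" by auto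
      then have "norm (F (Sup K) - F (Inf K)) \<le> L * norm (\<phi> (Sup K) - \<phi> (Inf K))"
        by (rule dom)
      also have "\<dots> \<le> M * norm (\<phi> (Sup K) - \<phi> (Inf K))"
        by (intro mult_right_mono) (auto simp: M_def)
      finally show ?thesis .
    qed
    then have "(\<Sum>K\<in>\<D>. norm (F (Sup K) - F (Inf K))) \<le> M * (\<Sum>K\<in>\<D>. norm (\<phi> (Sup K) - \<phi> (Inf K)))"
      unfolding sum_distrib_left by (intro sum_mono)
    also have "\<dots> < M * (e / M)"
      using AC'[OF *] M by (intro mult_strict_left_mono)
    finally show ?thesis using M by simp
  qed
  then show "\<exists>d>0. \<forall>\<D> S. \<D> division_of S \<and> S \<subseteq> {a..b} \<and> (\<Sum>K\<in>\<D>. Sup K - Inf K) < d \<longrightarrow>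
      (\<Sum>K\<in>\<D>. norm (F (Sup K) - F (Inf K))) < e"
    using d by blast
qed

lemma abs_continuous_on_add:
  assumes F: "abs_continuous_on a b F" and G: "abs_continuous_on a b G"
  shows "abs_continuous_on a b (\<lambda>t. F t + G t)"
  unfolding abs_continuous_on_def
proof (intro allI impI)
  fix e :: real assume e: "e > 0"
  obtain d1 where d1: "d1 > 0" and F': "\<And>\<D> S. \<D> division_of S \<Longrightarrow> S \<subseteq> {a..b} \<Longrightarrow>
      (\<Sum>K\<in>\<D>. Sup K - Inf K) < d1 \<Longrightarrow> (\<Sum>K\<in>\<D>. norm (F (Sup K) - F (Inf K))) < e / 2"
    using abs_continuous_onE[OF F half_gt_zero[OF e]] by blast
  obtain d2 where d2: "d2 > 0" and G': "\<And>\<D> S. \<D> division_of S \<Longrightarrow> S \<subseteq> {a..b} \<Longrightarrow>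
      (\<Sum>K\<in>\<D>. Sup K - Inf K) < d2 \<Longrightarrow> (\<Sum>K\<in>\<D>. norm (G (Sup K) - G (Inf K))) < e / 2"
    using abs_continuous_onE[OF G half_gt_zero[OF e]] by blast
  have "(\<Sum>K\<in>\<D>. norm (F (Sup K) + G (Sup K) - (F (Inf K) + G (Inf K)))) < e"
    if *: "\<D> division_of S" "S \<subseteq> {a..b}" "(\<Sum>K\<in>\<D>. Sup K - Inf K) < min d1 d2" for \<D> S
  proof -
    have "(\<Sum>K\<in>\<D>. norm (F (Sup K) + G (Sup K) - (F (Inf K) + G (Inf K))))
        \<le> (\<Sum>K\<in>\<D>. norm (F (Sup K) - F (Inf K)) + norm (G (Sup K) - G (Inf K)))"
      by (intro sum_mono) (metis add_diff_add norm_triangle_ineq)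
    also have "\<dots> < e"
      using F'[OF *(1,2)] G'[OF *(1,2)] *(3) by (simp add: sum.distrib)
    finally show ?thesis .
  qed
  then show "\<exists>d>0. \<forall>\<D> S. \<D> division_of S \<and> S \<subseteq> {a..b} \<and> (\<Sum>K\<in>\<D>. Sup K - Inf K) < d \<longrightarrow>
      (\<Sum>K\<in>\<D>. norm (F (Sup K) + G (Sup K) - (F (Inf K) + G (Inf K)))) < e"
    using d1 d2 by (intro exI[of _ "min d1 d2"]) auto
qed

lemma abs_continuous_on_sum:
  assumes "finite I" "\<And>i. i \<in> I \<Longrightarrow> abs_continuous_on a b (F i)"
  shows "abs_continuous_on a b (\<lambda>t. \<Sum>i\<in>I. F i t)"
  using assms
proof (induction I rule: finite_induct)
  case empty
  show ?case unfolding abs_continuous_on_def by (auto intro: exI[of _ 1])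
next
  case (insert i I)
  then show ?case by (simp add: abs_continuous_on_add)
qed

lemma abs_continuous_on_imp_continuous_on:
  assumes "abs_continuous_on a b F"
  shows "continuous_on {a..b} F"
  unfolding continuous_on_iff
proof (intro ballI allI impI)
  fix t e :: real assume t: "t \<in> {a..b}" and e: "e > 0"
  obtain d where d: "d > 0" and AC: "\<And>\<D> S. \<D> division_of S \<Longrightarrow> S \<subseteq> {a..b} \<Longrightarrow>
      (\<Sum>K\<in>\<D>. Sup K - Inf K) < d \<Longrightarrow> (\<Sum>K\<in>\<D>. norm (F (Sup K) - F (Inf K))) < e"
    using abs_continuous_onE[OF assms e] by blast
  have *: "dist (F u) (F v) < e" if "u \<le> v" "{u..v} \<subseteq> {a..b}" "v - u < d" for u v
  proof -
    have "{{u..v}} division_of {u..v}"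
      using division_of_self[of u v] that by simp
    then show ?thesis
      using AC[of "{{u..v}}" "{u..v}"] that by (simp add: dist_norm norm_minus_commute)
  qed
  have "dist (F s) (F t) < e" if "s \<in> {a..b}" "dist s t < d" for s
    using *[of s t] *[of t s] that t by (cases "s \<le> t") (auto simp: dist_real_def dist_commute)
  then show "\<exists>d>0. \<forall>s\<in>{a..b}. dist s t < d \<longrightarrow> dist (F s) (F t) < e"
    using d by blast
qed

text \<open>By continuity the norm is bounded by some \<open>M\<close> on the compact interval, and
  squaring is Lipschitz with constant \<open>2 * M\<close> on \<open>{0..M}\<close>.\<close>

lemma abs_continuous_on_norm_power2:
  assumes AC: "abs_continuous_on a b \<phi>"
  shows "abs_continuous_on a b (\<lambda>t. (norm (\<phi> t - c))\<^sup>2)"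
proof -
  have "continuous_on {a..b} (\<lambda>t. \<phi> t - c)"
    by (intro continuous_intros abs_continuous_on_imp_continuous_on AC)
  then have "bounded ((\<lambda>t. \<phi> t - c) ` {a..b})"
    by (intro compact_imp_bounded compact_continuous_image) auto
  then obtain M where "\<forall>z\<in>(\<lambda>t. \<phi> t - c) ` {a..b}. norm z \<le> M"
    unfolding bounded_iff ..
  then have M: "norm (\<phi> t - c) \<le> M" if "t \<in> {a..b}" for t
    using that by simp
  show ?thesis
  proof (rule abs_continuous_on_dominated[OF AC])
    fix s t assume st: "s \<in> {a..b}" "t \<in> {a..b}"
    let ?u = "norm (\<phi> s - c)" and ?v = "norm (\<phi> t - c)"
    have "\<bar>?u\<^sup>2 - ?v\<^sup>2\<bar> = (?u + ?v) * \<bar>?u - ?v\<bar>"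
      by (simp add: power2_eq_square square_diff_square_factored abs_mult)
    also have "\<dots> \<le> (2 * M) * norm (\<phi> s - \<phi> t)"
    proof (intro mult_mono)
      show "\<bar>?u - ?v\<bar> \<le> norm (\<phi> s - \<phi> t)"
        using norm_triangle_ineq3[of "\<phi> s - c" "\<phi> t - c"] by simp
      show "?u + ?v \<le> 2 * M" using M[OF st(1)] M[OF st(2)] by linarith
      show "0 \<le> 2 * M" using order_trans[OF norm_ge_zero M[OF st(1)]] by simp
    qed auto
    finally show "norm (?u\<^sup>2 - ?v\<^sup>2) \<le> (2 * M) * norm (\<phi> s - \<phi> t)" by simp
  qed
qed

section \<open>The nonnegative orthant and the positive part\<close>

lemma convex_nonneg_orthant: "convex (nonneg_orthant :: (real^'q::finite) set)"
  unfolding nonneg_orthant_def convex_def by (auto simp: less_eq_vec_def)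

lemma closed_nonneg_orthant: "closed (nonneg_orthant :: (real^'q::finite) set)"
  unfolding nonneg_orthant_def less_eq_vec_def
  by (simp add: closed_Collect_all closed_Collect_le continuous_intros)

lemma pos_part_vec_in_nonneg_orthant: "pos_part_vec v \<in> nonneg_orthant"
  unfolding pos_part_vec_def
  by (intro closest_point_in_set closed_nonneg_orthant) (auto simp: nonneg_orthant_def)

text \<open>The orthant is a cone, so 0 and twice the projection are both admissible test points;
  together they force the residual to be orthogonal to the projection.\<close>

lemma inner_pos_part_vec: "pos_part_vec v \<bullet> v = (norm (pos_part_vec v))\<^sup>2"
proof -
  let ?p = "pos_part_vec v"
  have *: "(v - ?p) \<bullet> (z - ?p) \<le> 0" if "z \<in> nonneg_orthant" for z
    unfolding pos_part_vec_def
    by (rule closest_point_dot[OF convex_nonneg_orthant closed_nonneg_orthant that])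
  have "2 *\<^sub>R ?p \<in> nonneg_orthant" "0 \<in> (nonneg_orthant :: (real^'a) set)"
    using pos_part_vec_in_nonneg_orthant[of v] by (auto simp: nonneg_orthant_def less_eq_vec_def)
  then have "(v - ?p) \<bullet> ?p = 0"
    using *[of 0] *[of "2 *\<^sub>R ?p"] by (simp add: inner_diff_right scaleR_2)
  then show ?thesis by (simp add: inner_diff_left inner_commute[of ?p v] power2_norm_eq_inner)
qed

lemma inner_vec_nonneg:
  fixes v w :: "real^'q::finite"
  assumes "0 \<le> v" "0 \<le> w"
  shows "0 \<le> v \<bullet> w"
  using assms by (auto simp: inner_vec_def less_eq_vec_def intro!: sum_nonneg)

section \<open>Subgradient inequalities and the Lyapunov estimate\<close>

text \<open>The subgradient inequalities of the cost and of the constraint components are added with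
  weights 1 and \<open>\<mu> $ k\<close>; nonnegative weights preserve their direction.\<close>

lemma lagr_subgrad_y_ineq:
  assumes h: "h \<in> lagr_subgrad_y W D \<phi> \<gamma> y \<mu>" and z: "z \<in> D" and \<mu>: "0 \<le> \<mu>"
  shows "h \<bullet> (z - y) \<le> \<phi> z - \<phi> y + \<mu> \<bullet> (\<gamma> z - \<gamma> y)"
proof -
  obtain hf hg where h: "h = hf + (\<Sum>k\<in>UNIV. \<mu> $ k *\<^sub>R hg k)"
    and hf: "hf \<in> subdiff W D \<phi> y" and hg: "\<And>k. hg k \<in> subdiff W D (\<lambda>w. \<gamma> w $ k) y"
    using h unfolding lagr_subgrad_y_def by blast
  have "h \<bullet> (z - y) = hf \<bullet> (z - y) + (\<Sum>k\<in>UNIV. \<mu> $ k * (hg k \<bullet> (z - y)))"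
    unfolding h by (simp add: inner_add_left inner_sum_left)
  also have "\<dots> \<le> (\<phi> z - \<phi> y) + (\<Sum>k\<in>UNIV. \<mu> $ k * (\<gamma> z $ k - \<gamma> y $ k))"
  proof (intro add_mono sum_mono mult_left_mono)
    show "hf \<bullet> (z - y) \<le> \<phi> z - \<phi> y"
      using hf z by (auto simp: subdiff_def)
    show "hg k \<bullet> (z - y) \<le> \<gamma> z $ k - \<gamma> y $ k" for k
      using hg[of k] z by (auto simp: subdiff_def)
    show "0 \<le> \<mu> $ k" for k using \<mu> by (simp add: less_eq_vec_def)
  qed
  also have "(\<Sum>k\<in>UNIV. \<mu> $ k * (\<gamma> z $ k - \<gamma> y $ k)) = \<mu> \<bullet> (\<gamma> z - \<gamma> y)"
    by (simp add: inner_vec_def)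
  finally show ?thesis by simp
qed

text \<open>For every selection the inner product equals the 1-norm of \<open>v\<close>, which
  dominates the Euclidean norm.\<close>

lemma Sgn_vec_inner_ge_norm:
  assumes "s \<in> Sgn_vec v"
  shows "norm v \<le> v \<bullet> s"
proof -
  have "\<bar>v $ k\<bar> = v $ k * s $ k" for k
    using assms by (auto simp: Sgn_vec_def Sgn_def split: if_splits dest!: spec[of _ k])
  then show ?thesis
    using norm_le_l1_cart[of v] by (simp add: inner_vec_def)
qed

text \<open>The antisymmetric edge selection cancels the reference point \<open>m\<close>.\<close>

lemma lagr_subgrad_mu_ineq:
  fixes \<mu> :: "'v::finite \<Rightarrow> real^'q::finite"
  assumes h: "h \<in> lagr_subgrad_mu E K \<gamma> \<mu>" and E: "sym E" and K: "K \<ge> 0"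
  shows "(\<Sum>i\<in>UNIV. (\<mu> i - m) \<bullet> h i) \<le> (\<Sum>i\<in>UNIV. (\<mu> i - m) \<bullet> \<gamma> i)
           - K * ((\<Sum>i\<in>UNIV. \<Sum>j\<in>UNIV. adj E i j * norm (\<mu> i - \<mu> j)) / 2)"
proof -
  obtain s where s: "\<And>i j. s i j \<in> Sgn_vec (\<mu> i - \<mu> j)" and anti: "\<And>i j. s j i = - s i j"
    and h: "\<And>i. h i = \<gamma> i - K *\<^sub>R (\<Sum>j\<in>UNIV. adj E i j *\<^sub>R s i j)"
    using h unfolding lagr_subgrad_mu_def by blast
  have adj: "adj E j i = adj E i j" "adj E i j \<ge> 0" for i j
    using E by (auto simp: adj_def sym_def)
  define D where "D = (\<Sum>i\<in>UNIV. \<Sum>j\<in>UNIV. adj E i j * ((\<mu> i - m) \<bullet> s i j))"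
  \<comment> \<open>Exchanging the roles of \<open>i\<close> and \<open>j\<close> gives a second
    form of \<open>D\<close>; in the sum of the two forms only \<open>\<mu> i - \<mu> j\<close> is
    left.\<close>
  have "D = (\<Sum>i\<in>UNIV. \<Sum>j\<in>UNIV. adj E j i * ((\<mu> j - m) \<bullet> s j i))"
    unfolding D_def by (rule sum.swap)
  also have "\<dots> = (\<Sum>i\<in>UNIV. \<Sum>j\<in>UNIV. - (adj E i j * ((\<mu> j - m) \<bullet> s i j)))"
  proof (intro sum.cong refl)
    fix i j
    show "adj E j i * ((\<mu> j - m) \<bullet> s j i) = - (adj E i j * ((\<mu> j - m) \<bullet> s i j))"
      using adj(1)[where i = i and j = j] anti[where i = i and j = j] by simp
  qed
  finally have "D + D = (\<Sum>i\<in>UNIV. \<Sum>j\<in>UNIV. adj E i j * ((\<mu> i - m) \<bullet> s i j))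
      + (\<Sum>i\<in>UNIV. \<Sum>j\<in>UNIV. - (adj E i j * ((\<mu> j - m) \<bullet> s i j)))"
    by (simp add: D_def)
  also have "\<dots> = (\<Sum>i\<in>UNIV. \<Sum>j\<in>UNIV. adj E i j * ((\<mu> i - \<mu> j) \<bullet> s i j))"
    unfolding sum.distrib[symmetric]
    by (intro sum.cong refl) (simp add: inner_diff_left algebra_simps)
  also have "\<dots> \<ge> (\<Sum>i\<in>UNIV. \<Sum>j\<in>UNIV. adj E i j * norm (\<mu> i - \<mu> j))"
    by (intro sum_mono mult_left_mono Sgn_vec_inner_ge_norm s adj)
  finally have "(\<Sum>i\<in>UNIV. \<Sum>j\<in>UNIV. adj E i j * norm (\<mu> i - \<mu> j)) / 2 \<le> D" by simp
  then have "K * ((\<Sum>i\<in>UNIV. \<Sum>j\<in>UNIV. adj E i j * norm (\<mu> i - \<mu> j)) / 2) \<le> K * D"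
    using K by (rule mult_left_mono)
  moreover have "(\<Sum>i\<in>UNIV. (\<mu> i - m) \<bullet> h i) = (\<Sum>i\<in>UNIV. (\<mu> i - m) \<bullet> \<gamma> i) - K * D"
    unfolding h D_def
    by (simp add: inner_diff_right inner_sum_right sum_subtractf sum_distrib_left)
  ultimately show ?thesis by simp
qed

text \<open>All multipliers are compared with that of one arbitrary agent \<open>o'\<close>. The
  common part is nonpositive by feasibility, and each deviation is at most half the edge sum, paired
  with a vector of norm at most \<open>R\<close>.\<close>

lemma sum_inner_le_disagreement:
  fixes \<mu> \<gamma> :: "'v::finite \<Rightarrow> real^'q::finite"
  assumes E: "connected_ugraph E" and \<mu>: "\<And>i. 0 \<le> \<mu> i"
    and \<gamma>: "(\<Sum>i\<in>UNIV. \<gamma> i) \<le> 0" "\<And>i. norm (\<gamma> i) \<le> R"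
  shows "(\<Sum>i\<in>UNIV. \<mu> i \<bullet> \<gamma> i)
           \<le> real CARD('v) * R * ((\<Sum>i\<in>UNIV. \<Sum>j\<in>UNIV. adj E i j * norm (\<mu> i - \<mu> j)) / 2)"
proof -
  define W where "W = (\<Sum>i\<in>UNIV. \<Sum>j\<in>UNIV. adj E i j * norm (\<mu> i - \<mu> j)) / 2"
  fix o' :: 'v
  have "(\<Sum>i\<in>UNIV. \<mu> i \<bullet> \<gamma> i) = (\<Sum>i\<in>UNIV. (\<mu> i - \<mu> o') \<bullet> \<gamma> i) + \<mu> o' \<bullet> (\<Sum>i\<in>UNIV. \<gamma> i)"
    by (simp add: inner_diff_left sum_subtractf inner_sum_right)
  also have "\<mu> o' \<bullet> (\<Sum>i\<in>UNIV. \<gamma> i) \<le> 0"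
    using inner_vec_nonneg[OF \<mu>[of o'], of "- (\<Sum>i\<in>UNIV. \<gamma> i)"] \<gamma>(1)
    by (simp add: less_eq_vec_def)
  also have "(\<Sum>i\<in>UNIV. (\<mu> i - \<mu> o') \<bullet> \<gamma> i) \<le> (\<Sum>i\<in>(UNIV::'v set). W * R)"
  proof (rule sum_mono)
    fix i
    have "(\<mu> i - \<mu> o') \<bullet> \<gamma> i \<le> norm (\<mu> i - \<mu> o') * norm (\<gamma> i)"
      by (rule norm_cauchy_schwarz)
    also have "\<dots> \<le> W * R"
      unfolding W_def using \<gamma>(2)[of i]
      by (intro mult_mono norm_diff_le_half_edge_sum[OF E])
         (auto intro!: sum_nonneg simp: adj_def)
    finally show "(\<mu> i - \<mu> o') \<bullet> \<gamma> i \<le> W * R" .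
  qed
  finally show ?thesis by (simp add: W_def mult_ac)
qed

text \<open>The left-hand side is half the derivative of the Lyapunov function along the closed
  loop. Each cost difference is at most \<open>2 * M\<close>, and the penalty \<open>K\<close>
  absorbs the disagreement caused by the constraint values at \<open>ystar\<close>.\<close>

lemma lyapunov_derivative_le:
  fixes \<mu> h :: "'v::finite \<Rightarrow> real^'q::finite" and y ystar hy :: "'v \<Rightarrow> real^'p::finite"
  assumes E: "connected_ugraph E" and \<epsilon>: "\<epsilon> > 0" and K: "K \<ge> real CARD('v) * R"
    and Y: "\<And>i. convex (Y i)" "\<And>i. closed (Y i)" "\<And>i. y i \<in> Y i" "\<And>i. ystar i \<in> Y i"
    and \<phi>: "\<And>i z. z \<in> Y i \<Longrightarrow> \<bar>\<phi> i z\<bar> \<le> M"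
    and \<gamma>: "\<And>i z. z \<in> Y i \<Longrightarrow> norm (\<gamma> i z) \<le> R" "(\<Sum>i\<in>UNIV. \<gamma> i (ystar i)) \<le> 0"
    and \<mu>: "\<And>i. \<mu> i \<in> nonneg_orthant" and m: "m \<in> nonneg_orthant"
    and hy: "\<And>i. hy i \<in> lagr_subgrad_y (W i) (Y i) (\<phi> i) (\<gamma> i) (y i) (\<mu> i)"
    and h: "h \<in> lagr_subgrad_mu E K (\<lambda>i. \<gamma> i (y i)) \<mu>"
  shows "(\<Sum>i\<in>UNIV. (y i - ystar i) \<bullet> proj_dir (Y i) (y i) (- \<epsilon> *\<^sub>R hy i)
             + (\<mu> i - m) \<bullet> proj_dir nonneg_orthant (\<mu> i) (\<epsilon> *\<^sub>R h i))
           \<le> \<epsilon> * (2 * real CARD('v) * M - m \<bullet> (\<Sum>i\<in>UNIV. \<gamma> i (y i)))" (is "?lhs \<le> _")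
proof -
  define D where "D = (\<Sum>i\<in>UNIV. \<Sum>j\<in>UNIV. adj E i j * norm (\<mu> i - \<mu> j)) / 2"
  have D: "D \<ge> 0" unfolding D_def by (auto intro!: sum_nonneg simp: adj_def)
  have \<mu>0: "0 \<le> \<mu> i" for i using \<mu> by (simp add: nonneg_orthant_def)
  have R: "R \<ge> 0" using order_trans[OF norm_ge_zero \<gamma>(1)[OF Y(3)]] .
  then have K0: "K \<ge> 0" using K by (meson mult_nonneg_nonneg of_nat_0_le_iff order_trans)
  have "?lhs \<le> (\<Sum>i\<in>UNIV. (y i - ystar i) \<bullet> (- \<epsilon> *\<^sub>R hy i) + (\<mu> i - m) \<bullet> (\<epsilon> *\<^sub>R h i))"
    by (intro sum_mono add_mono proj_dir_inner_le Y \<mu> m convex_nonneg_orthant closed_nonneg_orthant)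
  also have "\<dots> = \<epsilon> * ((\<Sum>i\<in>UNIV. hy i \<bullet> (ystar i - y i)) + (\<Sum>i\<in>UNIV. (\<mu> i - m) \<bullet> h i))"
    unfolding sum.distrib[symmetric] sum_distrib_left
    by (intro sum.cong refl) (simp add: inner_diff_left inner_diff_right inner_commute algebra_simps)
  also have "\<dots> \<le> \<epsilon> * (2 * real CARD('v) * M - m \<bullet> (\<Sum>i\<in>UNIV. \<gamma> i (y i)))"
  proof (rule mult_left_mono)
    have "(\<Sum>i\<in>UNIV. hy i \<bullet> (ystar i - y i))
        \<le> (\<Sum>i\<in>(UNIV::'v set). 2 * M + \<mu> i \<bullet> (\<gamma> i (ystar i) - \<gamma> i (y i)))"
    proof (rule sum_mono)
      fix i
      show "hy i \<bullet> (ystar i - y i) \<le> 2 * M + \<mu> i \<bullet> (\<gamma> i (ystar i) - \<gamma> i (y i))"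
        using lagr_subgrad_y_ineq[OF hy Y(4) \<mu>0, of i] \<phi>[OF Y(3)[of i]] \<phi>[OF Y(4)[of i]]
        by linarith
    qed
    moreover have "(\<Sum>i\<in>UNIV. (\<mu> i - m) \<bullet> h i) \<le> (\<Sum>i\<in>UNIV. (\<mu> i - m) \<bullet> \<gamma> i (y i)) - K * D"
      unfolding D_def using E K0 by (intro lagr_subgrad_mu_ineq[OF h]) (auto simp: connected_ugraph_def)
    moreover have "(\<Sum>i\<in>UNIV. \<mu> i \<bullet> \<gamma> i (ystar i)) \<le> real CARD('v) * R * D"
      unfolding D_def by (intro sum_inner_le_disagreement[OF E \<mu>0 \<gamma>(2)] \<gamma>(1) Y)
    moreover have "real CARD('v) * R * D \<le> K * D"
      using K D by (rule mult_right_mono)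
    \<comment> \<open>The terms \<open>\<mu> i \<bullet> \<gamma> i (y i)\<close> cancel between the
      primal and the dual bound.\<close>
    ultimately show "(\<Sum>i\<in>UNIV. hy i \<bullet> (ystar i - y i)) + (\<Sum>i\<in>UNIV. (\<mu> i - m) \<bullet> h i)
        \<le> 2 * real CARD('v) * M - m \<bullet> (\<Sum>i\<in>UNIV. \<gamma> i (y i))"
      by (simp add: sum.distrib inner_diff_left inner_diff_right sum_subtractf inner_sum_right)
  qed (use \<epsilon> in simp)
  finally show ?thesis .
qed

section \<open>Closed-loop output equation and auxiliary estimates\<close>

lemma AE_lebesgue_onE:
  assumes "AE t in lebesgue_on {a..b::real}. P t"
  obtains N where "negligible N" "\<And>t. t \<in> {a..b} - N \<Longrightarrow> P t"
proof -
  have "AE t in lebesgue. t \<in> {a..b} \<longrightarrow> P t"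
    using assms by (subst (asm) AE_restrict_space_iff) auto
  then obtain N where "N \<in> null_sets lebesgue" "{t. \<not> (t \<in> {a..b} \<longrightarrow> P t)} \<subseteq> N"
    unfolding eventually_ae_filter by auto
  then show ?thesis using that[of N] unfolding negligible_iff_null_sets by blast
qed

lemma subspace_coord_space: "subspace (coord_space J)"
  unfolding coord_space_def by (intro subspaceI) auto

lemma block_id_mult_coord_space:
  assumes "v \<in> coord_space J"
  shows "block_id J *v v = v"
proof -
  have "(\<Sum>c\<in>UNIV. block_id J $ r $ c * v $ c) = v $ r" for r
  proof -
    have "(\<Sum>c\<in>UNIV. block_id J $ r $ c * v $ c) = (\<Sum>c\<in>UNIV. if r = c then v $ r else 0)"
      using assms by (intro sum.cong) (auto simp: block_id_def coord_space_def)
    then show ?thesis by simp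
  qed
  then show ?thesis by (simp add: vec_eq_iff matrix_vector_mult_def)
qed

text \<open>The first gain cancels the drift \<open>C ** A\<close>, while
  \<open>C ** B ** Kb\<close> acts as the identity on vectors supported on \<open>J\<close>.\<close>

lemma closed_loop_output:
  fixes A :: "real^'n^'n::finite" and B :: "real^'m::finite^'n" and C :: "real^'n^'p::finite"
  assumes "C ** B ** Ka = C ** A" "C ** B ** Kb = block_id J" "v \<in> coord_space J"
  shows "C *v (A *v x + B *v (- (Ka *v x) + Kb *v v)) = v"
proof -
  have M: "M *v (- (Ka *v x) + Kb *v v) = M ** Kb *v v - M ** Ka *v x" for M :: "real^'m^'p"
    using matrix_vector_mult_diff_distrib[of M "Kb *v v" "Ka *v x"]
    by (simp add: matrix_vector_mul_assoc)
  have "C *v (A *v x + B *v (- (Ka *v x) + Kb *v v))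
      = C ** A *v x + C ** B *v (- (Ka *v x) + Kb *v v)"
    by (simp only: matrix_vector_right_distrib[of C] matrix_vector_mul_assoc[of C])
  also have "\<dots> = v"
    unfolding M assms(1,2) by (simp add: block_id_mult_coord_space assms(3))
  finally show ?thesis .
qed

lemma has_vector_derivative_norm_power2:
  fixes \<phi> :: "real \<Rightarrow> 'a::real_inner"
  assumes "(\<phi> has_vector_derivative D) (at t within S)"
  shows "((\<lambda>t. (norm (\<phi> t - c))\<^sup>2) has_vector_derivative 2 * ((\<phi> t - c) \<bullet> D)) (at t within S)"
  unfolding power2_norm_eq_inner has_vector_derivative_def
  by (rule derivative_eq_intros assms[unfolded has_vector_derivative_def] refl)+
     (simp add: fun_eq_iff inner_commute algebra_simps)

lemma norm_vec_power2: "(norm v)\<^sup>2 = (\<Sum>i\<in>UNIV. (norm (v $ i))\<^sup>2)"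
  for v :: "'a::real_inner^'v::finite"
  by (simp add: power2_norm_eq_inner inner_vec_def)

text \<open>Multiplied by \<open>n / \<epsilon>\<^sup>2\<close>, the right-hand side becomes the sum
  of the squares of the two summands of the claim, which is at most the square of their sum.\<close>

lemma le_of_quadratic_bound:
  fixes F D \<epsilon> K T n :: real
  assumes n: "n > 0" and \<epsilon>: "\<epsilon> > 0" and pos: "K \<ge> 0" "T \<ge> 0" "D \<ge> 0"
    and le: "\<epsilon>\<^sup>2 * F\<^sup>2 / n \<le> 4 * \<epsilon> * n * K * T + D\<^sup>2"
  shows "F \<le> sqrt n * D / \<epsilon> + 2 * n * sqrt (K / \<epsilon>) * sqrt T"
proof (rule power2_le_imp_le)
  let ?a = "sqrt n * D / \<epsilon>" and ?b = "2 * n * sqrt (K / \<epsilon>) * sqrt T"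
  have ab: "?a \<ge> 0" "?b \<ge> 0" using assms by auto
  have "F\<^sup>2 = (n / \<epsilon>\<^sup>2) * (\<epsilon>\<^sup>2 * F\<^sup>2 / n)" using n \<epsilon> by simp
  also have "\<dots> \<le> (n / \<epsilon>\<^sup>2) * (4 * \<epsilon> * n * K * T + D\<^sup>2)"
    using le n \<epsilon> by (intro mult_left_mono) auto
  also have "\<dots> = ?a\<^sup>2 + ?b\<^sup>2"
    using n \<epsilon> pos by (simp add: power_mult_distrib power_divide field_simps power2_eq_square)
  also have "\<dots> \<le> (?a + ?b)\<^sup>2"
    using mult_nonneg_nonneg[OF ab] by (simp only: power2_sum)
  finally show "F\<^sup>2 \<le> (?a + ?b)\<^sup>2" .
  show "0 \<le> ?a + ?b" using ab by simp
qed

section \<open>Bound on the constraint violation\<close>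

theorem theorem2:
  fixes Sx :: "'v::finite \<Rightarrow> 'n::finite set"
    and Su :: "'v \<Rightarrow> 'm::finite set"
    and Sy :: "'v \<Rightarrow> 'p::finite set"
    and A :: "'v \<Rightarrow> real^'n^'n" and B :: "'v \<Rightarrow> real^'m^'n" and C :: "'v \<Rightarrow> real^'n^'p"
    and K\<alpha> :: "'v \<Rightarrow> real^'n^'m" and K\<beta> :: "'v \<Rightarrow> real^'p^'m"
    and E :: "('v \<times> 'v) set"
    and Y :: "'v \<Rightarrow> (real^'p) set"
    and f :: "'v \<Rightarrow> real \<Rightarrow> real^'p \<Rightarrow> real"
    and g :: "'v \<Rightarrow> real \<Rightarrow> real^'p \<Rightarrow> real^'q::finite"
    and T \<epsilon> K\<^sub>f K\<^sub>g K\<^sub>\<mu> :: real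
    and ystar :: "real^'p^'v"
    and x :: "'v \<Rightarrow> real \<Rightarrow> real^'n" and u :: "'v \<Rightarrow> real \<Rightarrow> real^'m"
    and y :: "'v \<Rightarrow> real \<Rightarrow> real^'p" and \<mu> :: "'v \<Rightarrow> real \<Rightarrow> real^'q"
    and hy :: "'v \<Rightarrow> real \<Rightarrow> real^'p" and h\<mu> :: "'v \<Rightarrow> real \<Rightarrow> real^'q"
  assumes A_dim: "\<And>i. A i \<in> block_mat (Sx i) (Sx i)"
    and B_dim: "\<And>i. B i \<in> block_mat (Sx i) (Su i)"
    and C_dim: "\<And>i. C i \<in> block_mat (Sy i) (Sx i)"
    and K\<alpha>_dim: "\<And>i. K\<alpha> i \<in> block_mat (Su i) (Sx i)"
    and K\<beta>_dim: "\<And>i. K\<beta> i \<in> block_mat (Su i) (Sy i)"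
    and T_nonneg: "T \<ge> 0" and eps_pos: "\<epsilon> > 0"
    and A1: "connected_ugraph E"
    and A2_set: "\<And>i. Y i \<subseteq> coord_space (Sy i)" "\<And>i. convex (Y i)" "\<And>i. compact (Y i)"
    and A2_convex: "\<And>i t. t \<in> {0..T} \<Longrightarrow> convex_on (Y i) (f i t)"
      "\<And>i t k. t \<in> {0..T} \<Longrightarrow> convex_on (Y i) (\<lambda>z. g i t z $ k)"
    and A2_integrable: "\<And>i z. z \<in> Y i \<Longrightarrow> (\<lambda>t. f i t z) absolutely_integrable_on {0..T}"
      "\<And>i z. z \<in> Y i \<Longrightarrow> (\<lambda>t. g i t z) absolutely_integrable_on {0..T}"
    and A2_consts: "K\<^sub>f > 0" "K\<^sub>g > 0"
    and A2_bounded: "\<And>i t z. t \<in> {0..T} \<Longrightarrow> z \<in> Y i \<Longrightarrow> \<bar>f i t z\<bar> \<le> K\<^sub>f"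
      "\<And>i t z. t \<in> {0..T} \<Longrightarrow> z \<in> Y i \<Longrightarrow> norm (g i t z) \<le> K\<^sub>g"
    and A3: "feasible T Y g \<noteq> {}"
    and A4: "\<And>i. controllable (Sx i) (Su i) (A i) (B i)"
      "\<And>i. rank (C i ** B i) = card (Sy i)"
    and K\<alpha>: "\<And>i. C i ** B i ** K\<alpha> i = C i ** A i"
    and K\<beta>: "\<And>i. C i ** B i ** K\<beta> i = block_id (Sy i)"
    and optimal: "is_arg_min (\<lambda>z. integral {0..T} (\<lambda>t. \<Sum>i\<in>UNIV. f i t (z $ i)))
                    (\<lambda>z. z \<in> feasible T Y g) ystar"
    and x_dim: "\<And>i t. t \<in> {0..T} \<Longrightarrow> x i t \<in> coord_space (Sx i)"
    and abs_cont: "\<And>i. abs_continuous_on 0 T (x i)" "\<And>i. abs_continuous_on 0 T (\<mu> i)"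
    and y_output: "\<And>i t. t \<in> {0..T} \<Longrightarrow> y i t = C i *v x i t"
    and y_in: "\<And>i t. t \<in> {0..T} \<Longrightarrow> y i t \<in> Y i"
    and \<mu>_in: "\<And>i t. t \<in> {0..T} \<Longrightarrow> \<mu> i t \<in> nonneg_orthant"
    and dynamics: "\<And>i. AE t in lebesgue_on {0..T}.
          (x i has_vector_derivative (A i *v x i t + B i *v u i t)) (at t within {0..T})"
    and subgrad_y: "\<And>i. AE t in lebesgue_on {0..T}.
          hy i t \<in> lagr_subgrad_y (coord_space (Sy i)) (Y i) (f i t) (g i t) (y i t) (\<mu> i t)"
    and control: "\<And>i. AE t in lebesgue_on {0..T}.
          u i t = - (K\<alpha> i *v x i t) + K\<beta> i *v proj_dir (Y i) (y i t) (- \<epsilon> *\<^sub>R hy i t)"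
    and subgrad_\<mu>: "AE t in lebesgue_on {0..T}.
          (\<lambda>i. h\<mu> i t) \<in> lagr_subgrad_mu E K\<^sub>\<mu> (\<lambda>i. g i t (y i t)) (\<lambda>i. \<mu> i t)"
    and multiplier: "\<And>i. AE t in lebesgue_on {0..T}.
          (\<mu> i has_vector_derivative proj_dir nonneg_orthant (\<mu> i t) (\<epsilon> *\<^sub>R h\<mu> i t))
            (at t within {0..T})"
    and \<mu>_init: "\<And>i. \<mu> i 0 = 0"
    and K\<mu>_choice: "K\<^sub>\<mu> \<ge> real CARD('v) * K\<^sub>g"
  shows "norm (pos_part_vec (integral {0..T} (\<lambda>t. \<Sum>i\<in>UNIV. g i t (y i t))))
           \<le> sqrt (real CARD('v)) * norm ((\<chi> i. y i 0) - ystar) / \<epsilon>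
              + 2 * real CARD('v) * sqrt (K\<^sub>f / \<epsilon>) * sqrt T"
proof -
  define n where "n = real CARD('v)"
  have n: "n > 0" by (simp add: n_def)
  define G where "G t = (\<Sum>i\<in>UNIV. g i t (y i t))" for t
  define I where "I = integral {0..T} G"
  define D where "D = norm ((\<chi> i. y i 0) - ystar)"
  define P where "P = pos_part_vec I"
  have ystar: "ystar $ i \<in> Y i" and ystar_feas: "t \<in> {0..T} \<Longrightarrow> (\<Sum>i\<in>UNIV. g i t (ystar $ i)) \<le> 0" for i t
    using optimal by (auto simp: is_arg_min_def feasible_def)
  have clY: "closed (Y i)" for i
    using A2_set(3) by (rule compact_imp_closed)
  have "\<epsilon>\<^sup>2 * (norm P)\<^sup>2 / n \<le> 4 * \<epsilon> * n * K\<^sub>f * T + D\<^sup>2"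
  proof (cases "G integrable_on {0..T}")
    case False
    \<comment> \<open>measurability of \<open>t \<mapsto> g i t (y i t)\<close> is not assumed; the junk value of the integral is \<open>0\<close>\<close>
    then have "I = 0" unfolding I_def by (rule not_integrable_integral)
    then have "(norm P)\<^sup>2 = 0" using inner_pos_part_vec[of I] by (simp add: P_def)
    then show ?thesis using n eps_pos A2_consts T_nonneg by simp
  next
    case True
    \<comment> \<open>Among multiples of \<open>P\<close>, this one maximizes
      \<open>2 * \<epsilon> * (m \<bullet> I) - n * (norm m)\<^sup>2\<close>, the gain from the
      constraint integral minus the cost of \<open>m\<close> in \<open>V 0\<close>.\<close>
    define m where "m = (\<epsilon> / n) *\<^sub>R P"
    have m: "m \<in> nonneg_orthant"
      using pos_part_vec_in_nonneg_orthant[of I] n eps_pos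
      by (auto simp: m_def P_def nonneg_orthant_def less_eq_vec_def)
    define V where "V t = (\<Sum>i\<in>UNIV. (norm (y i t - ystar $ i))\<^sup>2 + (norm (\<mu> i t - m))\<^sup>2)" for t
    have ACy: "abs_continuous_on 0 T (y i)" for i
    proof (rule abs_continuous_on_dominated[OF abs_cont(1)])
      fix s t assume "s \<in> {0..T}" "t \<in> {0..T}"
      then have "y i s - y i t = C i *v (x i s - x i t)"
        by (simp add: y_output matrix_vector_mult_diff_distrib)
      then show "norm (y i s - y i t) \<le> onorm ((*v) (C i)) * norm (x i s - x i t)"
        by (simp add: onorm matrix_vector_mul_bounded_linear)
    qed
    have ACV: "abs_continuous_on 0 T V"
      unfolding V_def
      by (intro abs_continuous_on_sum abs_continuous_on_add abs_continuous_on_norm_power2 ACy abs_cont) simp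
    let ?loop = "\<lambda>i t.
        (x i has_vector_derivative (A i *v x i t + B i *v u i t)) (at t within {0..T}) \<and>
        hy i t \<in> lagr_subgrad_y (coord_space (Sy i)) (Y i) (f i t) (g i t) (y i t) (\<mu> i t) \<and>
        u i t = - (K\<alpha> i *v x i t) + K\<beta> i *v proj_dir (Y i) (y i t) (- \<epsilon> *\<^sub>R hy i t) \<and>
        (\<mu> i has_vector_derivative proj_dir nonneg_orthant (\<mu> i t) (\<epsilon> *\<^sub>R h\<mu> i t)) (at t within {0..T})"
    let ?sel = "\<lambda>t. (\<lambda>i. h\<mu> i t) \<in> lagr_subgrad_mu E K\<^sub>\<mu> (\<lambda>i. g i t (y i t)) (\<lambda>i. \<mu> i t)"
    \<comment> \<open>With finitely many agents, a single null set covers the exceptional times of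
      all closed-loop conditions.\<close>
    have "AE t in lebesgue_on {0..T}. \<forall>i\<in>UNIV. ?loop i t"
      by (intro AE_finite_allI AE_conjI dynamics subgrad_y control multiplier) simp
    then have "AE t in lebesgue_on {0..T}. (\<forall>i\<in>UNIV. ?loop i t) \<and> ?sel t"
      using subgrad_\<mu> by (rule AE_conjI)
    then obtain N where N: "negligible N"
      and loop: "\<And>t. t \<in> {0..T} - N \<Longrightarrow> (\<forall>i\<in>UNIV. ?loop i t) \<and> ?sel t"
      by (rule AE_lebesgue_onE) blast
    have "((\<lambda>t. m \<bullet> G t) has_integral m \<bullet> I) {0..T}"
      using has_integral_linear[OF integrable_integral[OF True] bounded_linear_inner_right[of m]]
      by (simp add: I_def o_def)
    moreover have "((\<lambda>t. 2 * n * K\<^sub>f) has_integral 2 * n * K\<^sub>f * T) {0..T}"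
      using has_integral_const_real[of "2 * n * K\<^sub>f" 0 T] T_nonneg by (simp add: mult_ac)
    ultimately have bound: "((\<lambda>t. 2 * \<epsilon> * (2 * n * K\<^sub>f - m \<bullet> G t))
        has_integral 2 * \<epsilon> * (2 * n * K\<^sub>f * T - m \<bullet> I)) {0..T}"
      by (intro has_integral_mult_right has_integral_diff)
    \<comment> \<open>Only the upper bound on the derivative has to be integrable here;
      integrability of the derivative itself need not be shown.\<close>
    have "V T - V 0 \<le> integral {0..T} (\<lambda>t. 2 * \<epsilon> * (2 * n * K\<^sub>f - m \<bullet> G t))"
    proof (rule abs_continuous_increment_le_integral[OF T_nonneg ACV N])
      fix t assume tN: "t \<in> {0..T} - N"
      then have t: "t \<in> {0..T}" by simp
      have dx: "(x i has_vector_derivative (A i *v x i t + B i *v u i t)) (at t within {0..T})"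
        and hy: "hy i t \<in> lagr_subgrad_y (coord_space (Sy i)) (Y i) (f i t) (g i t) (y i t) (\<mu> i t)"
        and u: "u i t = - (K\<alpha> i *v x i t) + K\<beta> i *v proj_dir (Y i) (y i t) (- \<epsilon> *\<^sub>R hy i t)"
        and d\<mu>: "(\<mu> i has_vector_derivative proj_dir nonneg_orthant (\<mu> i t) (\<epsilon> *\<^sub>R h\<mu> i t))
            (at t within {0..T})"
        and h\<mu>: "(\<lambda>i. h\<mu> i t) \<in> lagr_subgrad_mu E K\<^sub>\<mu> (\<lambda>i. g i t (y i t)) (\<lambda>i. \<mu> i t)" for i
        using loop[OF tN] by blast+
      have dy: "(y i has_vector_derivative proj_dir (Y i) (y i t) (- \<epsilon> *\<^sub>R hy i t)) (at t within {0..T})" for i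
      proof (rule has_vector_derivative_transform[OF t y_output])
        have "proj_dir (Y i) (y i t) (- \<epsilon> *\<^sub>R hy i t) \<in> coord_space (Sy i)"
          by (intro proj_dir_in_subspace A2_set clY y_in t subspace_coord_space)
        then have "C i *v (A i *v x i t + B i *v u i t) = proj_dir (Y i) (y i t) (- \<epsilon> *\<^sub>R hy i t)"
          unfolding u by (rule closed_loop_output[OF K\<alpha> K\<beta>])
        then show "((\<lambda>t. C i *v x i t) has_vector_derivative proj_dir (Y i) (y i t) (- \<epsilon> *\<^sub>R hy i t))
            (at t within {0..T})"
          using bounded_linear.has_vector_derivative[OF matrix_vector_mul_bounded_linear[of "C i"] dx[of i]]
          by simp
      qed
      let ?S = "\<Sum>i\<in>UNIV. (y i t - ystar $ i) \<bullet> proj_dir (Y i) (y i t) (- \<epsilon> *\<^sub>R hy i t)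
             + (\<mu> i t - m) \<bullet> proj_dir nonneg_orthant (\<mu> i t) (\<epsilon> *\<^sub>R h\<mu> i t)"
      have "(V has_vector_derivative 2 * ?S) (at t within {0..T})"
        unfolding V_def sum_distrib_left distrib_left
        by (intro has_vector_derivative_sum has_vector_derivative_add has_vector_derivative_norm_power2 dy d\<mu>)
      moreover have "?S \<le> \<epsilon> * (2 * real CARD('v) * K\<^sub>f - m \<bullet> (\<Sum>i\<in>UNIV. g i t (y i t)))"
        using A2_bounded[OF t]
        by (intro lyapunov_derivative_le[OF A1 eps_pos K\<mu>_choice A2_set(2) clY y_in[OF t] ystar
              _ _ ystar_feas[OF t] \<mu>_in[OF t] m hy h\<mu>])
      ultimately show "\<exists>D. (V has_vector_derivative D) (at t within {0..T})
          \<and> D \<le> 2 * \<epsilon> * (2 * n * K\<^sub>f - m \<bullet> G t)"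
        by (intro exI[of _ "2 * ?S"]) (simp add: n_def G_def)
    qed (rule has_integral_integrable[OF bound])
    also have "\<dots> = 2 * \<epsilon> * (2 * n * K\<^sub>f * T - m \<bullet> I)"
      by (rule integral_unique[OF bound])
    finally have VT: "V T - V 0 \<le> 2 * \<epsilon> * (2 * n * K\<^sub>f * T - m \<bullet> I)" .
    have "0 \<le> V T" unfolding V_def by (intro sum_nonneg) auto
    \<comment> \<open>Starting the multipliers at 0 makes their share of \<open>V 0\<close> exactly
      \<open>n * (norm m)\<^sup>2\<close>.\<close>
    moreover have "V 0 = D\<^sup>2 + n * (norm m)\<^sup>2"
      unfolding V_def D_def norm_vec_power2 by (simp add: \<mu>_init sum.distrib n_def)
    moreover have "m \<bullet> I = \<epsilon> / n * (norm P)\<^sup>2"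
      using inner_pos_part_vec[of I] by (simp add: m_def P_def)
    moreover have "n * (norm m)\<^sup>2 = \<epsilon>\<^sup>2 * (norm P)\<^sup>2 / n"
      using n by (simp add: m_def power_mult_distrib power_divide power2_eq_square)
    \<comment> \<open>Dropping \<open>V T \<ge> 0\<close> leaves twice
      \<open>\<epsilon>\<^sup>2 * (norm P)\<^sup>2 / n\<close> from the constraint integral against
      one such term from \<open>V 0\<close>.\<close>
    ultimately show ?thesis
      using VT by (simp add: algebra_simps power2_eq_square)
  qed
  then have "norm P \<le> sqrt n * D / \<epsilon> + 2 * n * sqrt (K\<^sub>f / \<epsilon>) * sqrt T"
    using n eps_pos A2_consts T_nonneg by (intro le_of_quadratic_bound) (auto simp: D_def)
  then show ?thesis by (simp add: P_def I_def G_def[abs_def] D_def n_def)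
qed

end
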